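(* Let $r$ be a positive integer. Every digraph $D$ with $\delta^0(D)\ge 3r$ has a spanning $6$-partite subdigraph $H$ with $\delta^0(H)\ge r$.
   Context: Digraphs are finite, without loops or parallel arcs (directed $2$-cycles are allowed). $\delta^0(D)$ is the minimum over all in-degrees and out-degrees of vertices of $D$. A subdigraph is spanning if it contains all vertices. A digraph is $6$-partite if its vertex set can be partitioned into $6$ (possibly empty) sets each of which induces no arc. *)

theory Defs
  imports "Graph_Theory.Digraph_Component" "HOL-Library.Disjoint_Sets"
begin

(* If G has no vertices this is Min {}, an unspecified number that is the same
   for all such G; the intended use is for nonempty vertex sets. *)
definition min_semidegree :: "('a, 'b) pre_digraph \<Rightarrow> nat" where
  "min_semidegree G = Min (in_degree G ` verts G \<union> out_degree G ` verts G)"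

(* The parts V i may be empty, so a k-partite digraph is also k'-partite for all k' \<ge> k. *)
definition multipartite :: "nat \<Rightarrow> ('a, 'b) pre_digraph \<Rightarrow> bool" where
  "multipartite k G \<longleftrightarrow>
     (\<exists>V :: nat \<Rightarrow> 'a set.
        (\<Union>i<k. V i) = verts G \<and> disjoint_family_on V {..<k} \<and>
        (\<forall>i<k. arcs (G \<restriction> V i) = {}))"

end

theory Submission
  imports Defs Complex_Main
begin

text \<open>
  Give every vertex weight \<open>1/2\<close> to spread evenly over its out-arcs and weight \<open>1/2\<close> to spread
  evenly over its in-arcs. Scaling the rows of this weight matrix by a stationary vector makes row
  and column sums agree, so in a 6-colouring that minimises the total scaled weight inside colour
  classes every vertex keeps at most \<open>2/6\<close> of its weight in its own class (this is Alon's
  argument for splitting digraphs). Hence at most \<open>2/3\<close> of its out-arcs, and at most \<open>2/3\<close> of its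
  in-arcs, are monochromatic.
\<close>

text \<open>The induction step eliminates a vertex \<open>v\<close> by replacing each path \<open>i, v, j\<close> with a shortcut,
  as in the censored Markov chain.\<close>

lemma stationary_weights_exist:
  fixes a :: "'a \<Rightarrow> 'a \<Rightarrow> real"
  assumes "finite S" and "\<And>i j. i \<in> S \<Longrightarrow> j \<in> S \<Longrightarrow> a i j > 0"
  shows "\<exists>u. (\<forall>i\<in>S. u i > 0) \<and> (\<forall>j\<in>S. (\<Sum>i\<in>S. u i * a i j) = u j * (\<Sum>k\<in>S. a j k))"
  using assms
proof (induction S arbitrary: a rule: finite_induct)
  case empty
  then show ?case by simp
next
  case (insert v S)
  show ?case
  proof (cases "S = {}")
    case True
    then show ?thesis by (intro exI[of _ "\<lambda>_. 1"]) simp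
  next
    case False
    define s where "s = (\<Sum>k\<in>S. a v k)"
    have s: "s > 0"
      unfolding s_def using insert False by (intro sum_pos) auto
    define a' where "a' = (\<lambda>i j. a i j + a i v * a v j / s)"
    have "a' i j > 0" if "i \<in> S" "j \<in> S" for i j
      unfolding a'_def using that insert.prems s by (intro add_pos_pos divide_pos_pos mult_pos_pos) auto
    then obtain u where u: "\<And>i. i \<in> S \<Longrightarrow> u i > 0"
      and bal: "\<And>j. j \<in> S \<Longrightarrow> (\<Sum>i\<in>S. u i * a' i j) = u j * (\<Sum>k\<in>S. a' j k)"
      using insert.IH[of a'] by blast
    \<comment> \<open>This value is forced: in the balance equation at \<open>v\<close> the loop
      term \<open>a v v\<close> occurs on both sides and cancels, which leaves the inflow from
      \<open>S\<close> equal to \<open>t * s\<close>.\<close>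
    define t where "t = (\<Sum>i\<in>S. u i * a i v) / s"
    have t: "t > 0"
      unfolding t_def using u s insert False by (intro divide_pos_pos sum_pos mult_pos_pos) auto
    let ?u = "u(v := t)"
    have S: "(\<Sum>i\<in>insert v S. ?u i * f i) = t * f v + (\<Sum>i\<in>S. u i * f i)" for f
    proof -
      have "(\<Sum>i\<in>S. ?u i * f i) = (\<Sum>i\<in>S. u i * f i)"
        using insert by (intro sum.cong) auto
      then show ?thesis using insert by simp
    qed
    have "(\<Sum>i\<in>insert v S. ?u i * a i j) = ?u j * (\<Sum>k\<in>insert v S. a j k)"
      if j: "j \<in> insert v S" for j
    proof (cases "j = v")
      case True
      have "(\<Sum>i\<in>S. u i * a i v) = t * s"
        using s by (simp add: t_def)
      then show ?thesis
        unfolding S using insert True by (simp add: s_def algebra_simps)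
    next
      case False
      then have j: "j \<in> S" using j by simp
      \<comment> \<open>The shortcuts carry exactly the flow that \<open>v\<close> sends on to
        \<open>j\<close>, and they make up for the lost arc from \<open>j\<close> to
        \<open>v\<close> in the row sum of \<open>j\<close>. So balance for \<open>a'\<close> on
        \<open>S\<close> is balance for \<open>a\<close> on the larger set.\<close>
      have "(\<Sum>i\<in>S. u i * a' i j) = (\<Sum>i\<in>S. u i * a i j) + t * a v j"
        by (simp add: a'_def t_def algebra_simps sum.distrib sum_distrib_left sum_divide_distrib)
      moreover have "(\<Sum>k\<in>S. a' j k) = (\<Sum>k\<in>S. a j k) + a j v"
        using s by (simp add: a'_def sum.distrib sum_divide_distrib[symmetric]
            sum_distrib_left[symmetric] s_def[symmetric])
      ultimately show ?thesis
        unfolding S using bal[OF j] insert False by (simp add: algebra_simps)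
    qed
    then show ?thesis
      using t u by (intro exI[of _ ?u]) auto
  qed
qed

text \<open>At a minimiser no single vertex gains by changing colour, so the scaled weight it shares
  with its own class, in both directions, is at most the average over all \<open>k\<close> classes.
  That average is at most 1/k times row sum plus column sum; these agree, hence the factor
  2.\<close>

lemma exists_splitting_colouring:
  fixes a :: "'a \<Rightarrow> 'a \<Rightarrow> real"
  assumes S: "finite S" and a: "\<And>i j. i \<in> S \<Longrightarrow> j \<in> S \<Longrightarrow> a i j > 0" and k: "k > 0"
  shows "\<exists>c :: 'a \<Rightarrow> nat. (\<forall>i\<in>S. c i < k) \<and>
    (\<forall>i\<in>S. real k * (\<Sum>j\<in>{j\<in>S - {i}. c j = c i}. a i j) \<le> 2 * (\<Sum>j\<in>S. a i j))"
proof -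
  obtain u where u: "\<And>i. i \<in> S \<Longrightarrow> u i > 0"
    and bal: "\<And>j. j \<in> S \<Longrightarrow> (\<Sum>i\<in>S. u i * a i j) = u j * (\<Sum>k\<in>S. a j k)"
    using stationary_weights_exist[OF S, of a] a by blast
  define b where "b i j = u i * a i j" for i j
  have b: "b i j > 0" if "i \<in> S" "j \<in> S" for i j
    using that u a by (simp add: b_def)
  define F where "F c = (\<Sum>i\<in>S. \<Sum>j\<in>S. if c i = c j then b i j else 0)" for c :: "'a \<Rightarrow> nat"
  \<comment> \<open>Apart from the diagonal term, this is what \<open>i\<close> would contribute to
    \<open>F\<close> if its colour were \<open>l\<close>.\<close>
  define g where "g c i l = (\<Sum>j\<in>S - {i}. if c j = l then b i j + b j i else 0)"
    for c :: "'a \<Rightarrow> nat" and i l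
  \<comment> \<open>Only the last summand depends on the colour of \<open>i\<close>, so recolouring
    \<open>i\<close> changes \<open>F\<close> by a difference of two values of
    \<open>g\<close>.\<close>
  have F_split: "F c = (\<Sum>i'\<in>S - {i}. \<Sum>j\<in>S - {i}. if c i' = c j then b i' j else 0)
      + b i i + g c i (c i)" if i: "i \<in> S" for c i
  proof -
    have "F c = (\<Sum>j\<in>S. if c i = c j then b i j else 0)
        + (\<Sum>i'\<in>S - {i}. \<Sum>j\<in>S. if c i' = c j then b i' j else 0)"
      unfolding F_def using S i by (rule sum.remove)
    also have "(\<Sum>j\<in>S. if c i = c j then b i j else 0)
        = b i i + (\<Sum>j\<in>S - {i}. if c i = c j then b i j else 0)"
      using sum.remove[OF S i, of "\<lambda>j. if c i = c j then b i j else 0"] by simp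
    also have "(\<Sum>i'\<in>S - {i}. \<Sum>j\<in>S. if c i' = c j then b i' j else 0)
        = (\<Sum>i'\<in>S - {i}. (if c i' = c i then b i' i else 0)
            + (\<Sum>j\<in>S - {i}. if c i' = c j then b i' j else 0))"
    proof (intro sum.cong refl)
      fix i'
      show "(\<Sum>j\<in>S. if c i' = c j then b i' j else 0) = (if c i' = c i then b i' i else 0)
          + (\<Sum>j\<in>S - {i}. if c i' = c j then b i' j else 0)"
        using S i by (rule sum.remove)
    qed
    moreover have "g c i (c i) = (\<Sum>j\<in>S - {i}. if c i = c j then b i j else 0)
        + (\<Sum>j\<in>S - {i}. if c j = c i then b j i else 0)"
      unfolding g_def sum.distrib[symmetric] by (intro sum.cong) auto
    ultimately show ?thesis by (simp add: sum.distrib)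
  qed
  \<comment> \<open>Restricting to extensional functions makes the set of colourings finite, so that
    a minimiser exists.\<close>
  let ?C = "S \<rightarrow>\<^sub>E {..<k}"
  have "finite ?C" "?C \<noteq> {}"
    using S k by (auto intro!: finite_PiE simp: PiE_eq_empty_iff)
  then obtain c where c: "c \<in> ?C" and min: "\<And>c'. c' \<in> ?C \<Longrightarrow> F c \<le> F c'"
    using ex_min_if_finite[of "F ` ?C"] by (metis (no_types, lifting) arg_min_least arg_min_if_finite(1))
  have g_min: "g c i (c i) \<le> g c i l" if i: "i \<in> S" and l: "l < k" for i l
  proof -
    let ?c = "c(i := l)"
    have "F c \<le> F ?c"
      using c i l by (intro min) (auto simp: PiE_iff extensional_def)
    moreover have "(\<Sum>i'\<in>S - {i}. \<Sum>j\<in>S - {i}. if ?c i' = ?c j then b i' j else 0)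
        = (\<Sum>i'\<in>S - {i}. \<Sum>j\<in>S - {i}. if c i' = c j then b i' j else 0)"
      by (intro sum.cong) auto
    moreover have "g ?c i (?c i) = g c i l"
      unfolding g_def by (intro sum.cong) auto
    ultimately show ?thesis
      using F_split[OF i, of c] F_split[OF i, of ?c] by simp
  qed
  have "real k * (\<Sum>j\<in>{j\<in>S - {i}. c j = c i}. a i j) \<le> 2 * (\<Sum>j\<in>S. a i j)" if i: "i \<in> S" for i
  proof -
    have "u i * (\<Sum>j\<in>{j\<in>S - {i}. c j = c i}. a i j) = (\<Sum>j\<in>S - {i}. if c j = c i then b i j else 0)"
      unfolding sum_distrib_left b_def[symmetric] using S by (intro sum.inter_filter) simp
    also have "\<dots> \<le> g c i (c i)"
      unfolding g_def using b i by (intro sum_mono) (auto simp: less_imp_le)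
    finally have "real k * (u i * (\<Sum>j\<in>{j\<in>S - {i}. c j = c i}. a i j)) \<le> (\<Sum>l<k. g c i (c i))"
      by (simp add: mult_left_mono)
    also have "\<dots> \<le> (\<Sum>l<k. g c i l)"
      using g_min[OF i] by (intro sum_mono) auto
    also have "\<dots> = (\<Sum>j\<in>S - {i}. \<Sum>l<k. if c j = l then b i j + b j i else 0)"
      unfolding g_def by (rule sum.swap)
    \<comment> \<open>Each \<open>j\<close> has exactly one colour below \<open>k\<close>, so the
      sum over \<open>l\<close> counts it once.\<close>
    also have "\<dots> = (\<Sum>j\<in>S - {i}. b i j + b j i)"
      using c by (intro sum.cong) (auto simp: PiE_iff)
    \<comment> \<open>Restoring the diagonal gives a full row sum and a full column sum, which
      \<open>bal\<close> identifies.\<close>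
    also have "\<dots> \<le> (\<Sum>j\<in>S. b i j + b j i)"
      using b i S by (intro sum_mono2) (auto intro: add_nonneg_nonneg less_imp_le)
    also have "\<dots> = u i * (2 * (\<Sum>j\<in>S. a i j))"
      using bal[OF i] by (simp add: sum.distrib b_def sum_distrib_left[symmetric])
    finally show ?thesis
      using u[OF i] by (simp add: mult.left_commute[of "real k"])
  qed
  then show ?thesis
    using c by (intro exI[of _ c]) (auto simp: PiE_iff)
qed

text \<open>The tolerance \<open>\<epsilon>\<close> absorbs the perturbation that makes all weights positive; it is harmless
  because arc counts are integers.\<close>

lemma third_bichromatic:
  fixes d m r :: nat and \<epsilon> :: real
  assumes "real m / real d \<le> (2 + \<epsilon>) / 3" and "\<epsilon> * real d < 1" and "3 * r \<le> d" and "r > 0"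
  shows "r \<le> d - m"
proof -
  \<comment> \<open>Clearing the denominator is legitimate because \<open>r > 0\<close> and
    \<open>3 * r \<le> d\<close> exclude \<open>d = 0\<close>.\<close>
  have "real m * 3 \<le> (2 + \<epsilon>) * real d"
    using assms by (simp add: field_simps)
  then have "real (3 * m) < real (2 * d + 1)"
    using assms(2) by (simp add: algebra_simps)
  then have "3 * m < 2 * d + 1"
    by (simp only: of_nat_less_iff)
  then show ?thesis
    using assms(3) by linarith
qed

lemma sum_card_fibres:
  assumes "finite A" and "finite T"
  shows "(\<Sum>j\<in>T. card {e\<in>A. f e = j}) = card {e\<in>A. f e \<in> T}"
proof -
  have "card {e\<in>A. f e \<in> T} = card (\<Union>j\<in>T. {e\<in>A. f e = j})"
    by (rule arg_cong[of _ _ card]) auto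
  also have "\<dots> = (\<Sum>j\<in>T. card {e\<in>A. f e = j})"
    using assms by (intro card_UN_disjoint) auto
  finally show ?thesis by simp
qed

lemma min_semidegree_geD:
  assumes "finite (verts G)" and "v \<in> verts G" and "min_semidegree G \<ge> k"
  shows "in_degree G v \<ge> k" and "out_degree G v \<ge> k"
proof -
  have "in_degree G v \<ge> min_semidegree G" "out_degree G v \<ge> min_semidegree G"
    unfolding min_semidegree_def using assms(1,2) by (auto intro!: Min_le)
  then show "in_degree G v \<ge> k" "out_degree G v \<ge> k"
    using assms(3) by auto
qed

text \<open>One inequality per vertex has to control both directions. Its total weight is about 2,
  so six colours leave at most about 2/3 inside its class. Even if all of this falls on one
  direction, where the total is 1, about a third of the arcs in that direction join different
  colours.\<close>

lemma (in digraph) exists_six_colouring: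
  assumes r: "r > 0"
    and deg: "\<And>v. v \<in> verts G \<Longrightarrow> in_degree G v \<ge> 3 * r \<and> out_degree G v \<ge> 3 * r"
  shows "\<exists>c :: 'a \<Rightarrow> nat. (\<forall>v\<in>verts G. c v < 6) \<and>
    (\<forall>v\<in>verts G. r \<le> card {e\<in>in_arcs G v. c (tail G e) \<noteq> c v} \<and>
                  r \<le> card {e\<in>out_arcs G v. c (head G e) \<noteq> c v})"
proof -
  let ?n = "card (verts G)"
  \<comment> \<open>A degree is at most the number of arcs, so the extra row weight
    \<open>?n * \<epsilon>\<close> times any degree stays below 1. Without vertices the quotient is
    0, which is why positivity is shown relative to a vertex.\<close>
  define \<epsilon> where "\<epsilon> = 1 / (real ?n * (real (card (arcs G)) + 1))"
  define p where "p i j = real (card {e\<in>out_arcs G i. head G e = j}) / real (out_degree G i)" for i j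
  define q where "q i j = real (card {e\<in>in_arcs G i. tail G e = j}) / real (in_degree G i)" for i j
  \<comment> \<open>The weights of the outline are doubled here: \<open>p\<close> and
    \<open>q\<close> each have row sum 1.\<close>
  define a where "a i j = p i j + q i j + \<epsilon>" for i j
  have p_sum: "(\<Sum>j\<in>T. p i j) = real (card {e\<in>out_arcs G i. head G e \<in> T}) / real (out_degree G i)"
    if "finite T" for i T
    unfolding p_def sum_divide_distrib[symmetric] of_nat_sum[symmetric]
    using that by (subst sum_card_fibres) auto
  have q_sum: "(\<Sum>j\<in>T. q i j) = real (card {e\<in>in_arcs G i. tail G e \<in> T}) / real (in_degree G i)"
    if "finite T" for i T
    unfolding q_def sum_divide_distrib[symmetric] of_nat_sum[symmetric]
    using that by (subst sum_card_fibres) auto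
  have nonneg: "p i j \<ge> 0" "q i j \<ge> 0" for i j
    by (simp_all add: p_def q_def)
  have \<epsilon>_pos: "\<epsilon> > 0" if "v \<in> verts G" for v
  proof -
    have "?n > 0" using that by (auto simp: card_gt_0_iff)
    then show ?thesis unfolding \<epsilon>_def by (intro divide_pos_pos mult_pos_pos) auto
  qed
  have pos: "a i j > 0" if "i \<in> verts G" for i j
    using nonneg[of i j] \<epsilon>_pos[OF that] by (simp add: a_def)
  obtain c :: "'a \<Rightarrow> nat" where c: "\<And>v. v \<in> verts G \<Longrightarrow> c v < 6"
    and split: "\<And>i. i \<in> verts G \<Longrightarrow>
      6 * (\<Sum>j\<in>{j\<in>verts G - {i}. c j = c i}. a i j) \<le> 2 * (\<Sum>j\<in>verts G. a i j)"
    using exists_splitting_colouring[of "verts G" a 6] pos by fastforce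
  have "r \<le> card {e\<in>in_arcs G v. c (tail G e) \<noteq> c v} \<and>
        r \<le> card {e\<in>out_arcs G v. c (head G e) \<noteq> c v}" if v: "v \<in> verts G" for v
  proof -
    let ?T = "{j\<in>verts G - {v}. c j = c v}"
    let ?m = "card {e\<in>in_arcs G v. c (tail G e) = c v}"
    let ?m' = "card {e\<in>out_arcs G v. c (head G e) = c v}"
    note \<epsilon> = \<epsilon>_pos[OF v]
    have d: "in_degree G v > 0" "out_degree G v > 0"
      using deg[OF v] r by auto
    have out_all: "{e\<in>out_arcs G v. head G e \<in> verts G} = out_arcs G v"
      and in_all: "{e\<in>in_arcs G v. tail G e \<in> verts G} = in_arcs G v"
      by auto
    \<comment> \<open>As there are no loops, leaving \<open>v\<close> out of its own class loses
      none of its monochromatic arcs.\<close>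
    have out_T: "{e\<in>out_arcs G v. head G e \<in> ?T} = {e\<in>out_arcs G v. c (head G e) = c v}"
      and in_T: "{e\<in>in_arcs G v. tail G e \<in> ?T} = {e\<in>in_arcs G v. c (tail G e) = c v}"
      by (auto dest: no_loops)
    have "(\<Sum>j\<in>verts G. p v j) = 1" "(\<Sum>j\<in>verts G. q v j) = 1"
      unfolding p_sum[OF finite_verts] q_sum[OF finite_verts] out_all in_all
      using d by (simp_all add: out_degree_def in_degree_def)
    then have "(\<Sum>j\<in>verts G. a v j) = 2 + ?n * \<epsilon>"
      by (simp add: a_def sum.distrib)
    moreover have "(\<Sum>j\<in>?T. a v j)
        = real ?m' / out_degree G v + real ?m / in_degree G v + card ?T * \<epsilon>"
      unfolding a_def sum.distrib
      using p_sum[of ?T v] q_sum[of ?T v] unfolding out_T in_T by simp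
    ultimately have total: "6 * (real ?m' / out_degree G v + real ?m / in_degree G v + card ?T * \<epsilon>)
        \<le> 2 * (2 + ?n * \<epsilon>)"
      using split[OF v] by metis
    have third: "x \<le> z / 3" "y \<le> z / 3"
      if "6 * (x + y + t) \<le> 2 * z" "x \<ge> 0" "y \<ge> 0" "t \<ge> 0" for x y z t :: real
      using that by (simp_all add: field_simps)
    have frac: "real ?m / in_degree G v \<le> (2 + ?n * \<epsilon>) / 3"
      by (rule third(2)[OF total]) (use \<epsilon> in simp_all)
    have frac': "real ?m' / out_degree G v \<le> (2 + ?n * \<epsilon>) / 3"
      by (rule third(1)[OF total]) (use \<epsilon> in simp_all)
    have n\<epsilon>: "?n * \<epsilon> = 1 / (real (card (arcs G)) + 1)"
      using v by (auto simp: \<epsilon>_def)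
    have "in_degree G v \<le> card (arcs G)" "out_degree G v \<le> card (arcs G)"
      unfolding in_degree_def out_degree_def by (auto intro!: card_mono)
    then have small: "?n * \<epsilon> * in_degree G v < 1" "?n * \<epsilon> * out_degree G v < 1"
      unfolding n\<epsilon> by (simp_all add: field_simps)
    have compl: "card {e\<in>A. \<not> P e} = card A - card {e\<in>A. P e}" if "finite A" for A :: "'b set" and P
    proof -
      have "{e\<in>A. \<not> P e} = A - {e\<in>A. P e}" by auto
      then show ?thesis using that by (simp add: card_Diff_subset)
    qed
    show ?thesis
      unfolding compl[OF finite_in_arcs] compl[OF finite_out_arcs]
        in_degree_def[symmetric] out_degree_def[symmetric]
      using third_bichromatic[OF frac small(1)] third_bichromatic[OF frac' small(2)]
        deg[OF v] r by simp
  qed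
  then show ?thesis using c by blast
qed

theorem corollary7p8:
  fixes D :: "('a, 'b) pre_digraph" and r :: nat
  assumes "r > 0"
    and "digraph D"
    and "min_semidegree D \<ge> 3 * r"
  shows "\<exists>H. spanning H D \<and> multipartite 6 H \<and> min_semidegree H \<ge> r"
proof -
  interpret D: digraph D by fact
  obtain c :: "'a \<Rightarrow> nat" where c: "\<And>v. v \<in> verts D \<Longrightarrow> c v < 6"
    and deg: "\<And>v. v \<in> verts D \<Longrightarrow> r \<le> card {e\<in>in_arcs D v. c (tail D e) \<noteq> c v}"
      "\<And>v. v \<in> verts D \<Longrightarrow> r \<le> card {e\<in>out_arcs D v. c (head D e) \<noteq> c v}"
    using D.exists_six_colouring[OF assms(1)] min_semidegree_geD[OF D.finite_verts _ assms(3)]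
    by blast
  define H where "H = D\<lparr>arcs := {e\<in>arcs D. c (tail D e) \<noteq> c (head D e)}\<rparr>"
  have H [simp]: "verts H = verts D" "arcs H = {e\<in>arcs D. c (tail D e) \<noteq> c (head D e)}"
    "tail H = tail D" "head H = head D"
    by (simp_all add: H_def)
  have "wf_digraph H"
    by unfold_locales auto
  then have "spanning H D"
    by (auto simp: spanning_def subgraph_def compatible_def D.wf_digraph_axioms)
  moreover have "multipartite 6 H"
    unfolding multipartite_def
    using c by (intro exI[of _ "\<lambda>i. {v\<in>verts D. c v = i}"])
      (auto simp: disjoint_family_on_def)
  moreover have "min_semidegree H \<ge> r"
  proof (cases "verts D = {}")
    case True
    \<comment> \<open>Both semidegrees are the same unspecified \<open>Min {}\<close>, so the
      hypothesis on \<open>D\<close> bounds it for \<open>H\<close> too.\<close>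
    then show ?thesis using assms(3) by (simp add: min_semidegree_def)
  next
    case False
    have "in_arcs H v = {e\<in>in_arcs D v. c (tail D e) \<noteq> c v}"
      "out_arcs H v = {e\<in>out_arcs D v. c (head D e) \<noteq> c v}" for v
      by (auto simp: in_arcs_def out_arcs_def)
    then have "in_degree H v \<ge> r" "out_degree H v \<ge> r" if "v \<in> verts D" for v
      using deg[OF that] by (simp_all add: in_degree_def out_degree_def)
    then show ?thesis
      using False by (auto simp: min_semidegree_def Min_ge_iff)
  qed
  ultimately show ?thesis by blast
qed

end
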